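(* Let $q$ be a prime power, $n$ a positive integer coprime to $q$, and $\gamma\in\mathbb{Z}/n\mathbb{Z}$. Then the polynomial $M_{c_{n/q}(\gamma)}(X)$ is a binomial (i.e. of the form $X^{\tau}+a$, where $\tau=|c_{n/q}(\gamma)|$) if and only if $c_{n/q}(\gamma)$ is of equal difference.
   Context: $c_{n/q}(\gamma)=\{\gamma,\gamma q,\dots,\gamma q^{\tau-1}\}\subseteq\mathbb{Z}/n\mathbb{Z}$ with $\tau$ least positive such that $\gamma q^\tau\equiv\gamma\pmod n$. The coset is of equal difference if $\tau\mid n$ and $c_{n/q}(\gamma)=\{\gamma,\gamma+\frac n\tau,\dots,\gamma+(\tau-1)\frac n\tau\}$ in $\mathbb{Z}/n\mathbb{Z}$ (one-element cosets included). Fix in an algebraic closure of $\mathbb{F}_q$ a compatible family $\{\zeta_m:\gcd(m,q)=1\}$ of primitive $m$-th roots of unity, i.e. $\zeta_n^{n/m}=\zeta_m$ whenever $m\mid n$. Then $M_{c_{n/q}(\gamma)}(X)=\prod_{j=0}^{\tau-1}(X-\zeta_n^{\gamma q^j})$, an irreducible factor of $X^n-1$ over $\mathbb{F}_q$. *)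

theory Defs
  imports
    "HOL-Library.Cardinality"
    "HOL-Algebra.Algebraic_Closure_Type"
    "HOL-Number_Theory.Cong"
    "HOL-Number_Theory.Prime_Powers"
begin

text \<open>
  The ring \<open>\<int>/n\<int>\<close> is represented by the residues \<open>0, \<dots>, n - 1\<close> as natural numbers.
\<close>

definition coset_period :: "nat \<Rightarrow> nat \<Rightarrow> nat \<Rightarrow> nat" where
  "coset_period n q \<gamma> = (LEAST t. 0 < t \<and> [\<gamma> * q ^ t = \<gamma>] (mod n))"

definition cyclotomic_coset :: "nat \<Rightarrow> nat \<Rightarrow> nat \<Rightarrow> nat set" where
  "cyclotomic_coset n q \<gamma> = (\<lambda>j. (\<gamma> * q ^ j) mod n) ` {..<coset_period n q \<gamma>}"

definition equal_difference :: "nat \<Rightarrow> nat \<Rightarrow> nat \<Rightarrow> bool" where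
  "equal_difference n q \<gamma> \<longleftrightarrow>
     (let \<tau> = coset_period n q \<gamma> in
        \<tau> dvd n \<and>
        cyclotomic_coset n q \<gamma> = (\<lambda>i. (\<gamma> + i * (n div \<tau>)) mod n) ` {..<\<tau>})"

definition primitive_root_of_unity :: "nat \<Rightarrow> 'a::field \<Rightarrow> bool" where
  "primitive_root_of_unity m z \<longleftrightarrow> z ^ m = 1 \<and> (\<forall>k. 0 < k \<and> k < m \<longrightarrow> z ^ k \<noteq> 1)"

text \<open>Only the values \<open>\<zeta> m\<close> with \<open>m > 0\<close> coprime to \<open>q\<close> are constrained.\<close>

definition compatible_roots_of_unity :: "nat \<Rightarrow> (nat \<Rightarrow> 'a::field) \<Rightarrow> bool" where
  "compatible_roots_of_unity q \<zeta> \<longleftrightarrow>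
     (\<forall>m. 0 < m \<and> coprime m q \<longrightarrow> primitive_root_of_unity m (\<zeta> m)) \<and>
     (\<forall>n m. 0 < n \<and> coprime n q \<and> m dvd n \<longrightarrow> \<zeta> n ^ (n div m) = \<zeta> m)"

definition coset_poly :: "(nat \<Rightarrow> 'a::field) \<Rightarrow> nat \<Rightarrow> nat \<Rightarrow> nat \<Rightarrow> 'a poly" where
  "coset_poly \<zeta> n q \<gamma> = (\<Prod>j<coset_period n q \<gamma>. [:- (\<zeta> n ^ (\<gamma> * q ^ j)), 1:])"

text \<open>
  \<^const>\<open>coset_poly\<close> lives over the algebraic closure but has coefficients in the base field, so
  being a binomial is expressed over the base field, embedded by \<^const>\<open>to_ac\<close>.
\<close>

definition is_binomial_of_degree :: "nat \<Rightarrow> 'a::field alg_closure poly \<Rightarrow> bool" where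
  "is_binomial_of_degree d p \<longleftrightarrow>
     (\<exists>a::'a. p = map_poly to_ac (Polynomial.monom 1 d + [:a:]))"

end

(* The coset polynomial is monic with the tau distinct roots zeta^x, x in the coset, so it equals
   X^tau - c precisely when (zeta^x)^tau = c for all those x, that is, when tau * x = tau * gamma
   modulo n on the whole coset.  That congruence has exactly gcd(tau, n) solutions, which form an
   arithmetic progression with step n / gcd(tau, n); as the coset already supplies tau solutions,
   tau divides n and the coset is the entire progression.  In the converse direction c lies in the
   base field because multiplication of the exponent by q permutes the coset, so c^q = c. *)
theory Submission
  imports Defs "HOL-Number_Theory.Residues"
begin

section \<open>Finite fields and roots of unity\<close>

lemma finite_field_power_card:
  fixes a :: "'a::{field,finite}"
  shows "a ^ CARD('a) = a"
proof (cases "a = 0")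
  case False
  let ?U = "UNIV - {0::'a}"
  \<comment> \<open>Multiplication by a nonzero \<open>a\<close> permutes the nonzero elements;
    comparing the products over them leaves \<open>a ^ card ?U = 1\<close>.\<close>
  have "bij_betw ((*) a) ?U ?U"
    by (rule bij_betwI[where g = "\<lambda>x. x / a"]) (use False in auto)
  hence "(\<Prod>x\<in>?U. a * x) = \<Prod>?U"
    by (rule prod.reindex_bij_betw)
  hence "a ^ card ?U * \<Prod>?U = \<Prod>?U"
    by (simp add: prod.distrib)
  moreover have "\<Prod>?U \<noteq> 0" by simp
  ultimately have *: "a ^ card ?U = 1" by simp
  have "CARD('a) = Suc (card ?U)"
    by (metis card_Suc_Diff1 finite UNIV_I)
  thus ?thesis using * by (simp only: power_Suc mult_1_right)
qed (simp add: power_0_left)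

text \<open>X^q - X has at most q roots, and the q embedded elements of the base field are already
  that many. This is the test used later to descend a constant from the closure to the base
  field.\<close>

lemma power_card_eq_self_iff_range_to_ac:
  fixes x :: "'a::{field,finite} alg_closure"
  shows "x ^ CARD('a) = x \<longleftrightarrow> x \<in> range to_ac"
proof
  let ?q = "CARD('a)"
  let ?p = "Polynomial.monom 1 ?q + [:0, - 1:] :: 'a alg_closure poly"
  let ?R = "{x. poly ?p x = 0}"
  have q: "?q > 1"
    using card_mono[of UNIV "{0, 1::'a}"] by simp
  have deg: "degree ?p = ?q"
    by (subst degree_add_eq_left) (use q in \<open>auto simp: degree_monom_eq\<close>)
  have p: "?p \<noteq> 0"
    using deg q by auto
  have "range to_ac \<subseteq> ?R"
    by (auto simp: poly_monom simp flip: to_ac_power simp: finite_field_power_card)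
  moreover have "card ?R \<le> card (range (to_ac :: 'a \<Rightarrow> _))"
    using card_poly_roots_bound[OF p] deg by (simp add: card_image inj_to_ac)
  moreover have "finite ?R"
    using p by (rule poly_roots_finite)
  ultimately have "range to_ac = ?R"
    by (intro card_seteq) auto
  moreover assume "x ^ ?q = x"
  ultimately show "x \<in> range to_ac"
    by (simp add: poly_monom)
qed (auto simp: finite_field_power_card simp flip: to_ac_power)

text \<open>Exponents may be reduced modulo \<open>n\<close>. If distinct exponents below
  \<open>n\<close> gave the same power, cancelling the smaller one would leave a power equal to 1
  with exponent strictly between 0 and \<open>n\<close>, against primitivity.\<close>

lemma primitive_root_of_unity_power_eq_iff:
  assumes "primitive_root_of_unity n z" "n > 0"
  shows "z ^ a = z ^ b \<longleftrightarrow> [a = b] (mod n)"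
proof -
  have z: "z ^ n = 1" "\<And>k. 0 < k \<Longrightarrow> k < n \<Longrightarrow> z ^ k \<noteq> 1"
    using assms by (auto simp: primitive_root_of_unity_def)
  have "z \<noteq> 0"
    using z(1) \<open>n > 0\<close> by (auto simp: power_0_left)
  have red: "z ^ k = z ^ (k mod n)" for k
  proof -
    have "z ^ k = z ^ (n * (k div n) + k mod n)" by simp
    also have "\<dots> = z ^ (k mod n)" by (simp only: power_add power_mult z(1)) simp
    finally show ?thesis .
  qed
  have le: "i = j" if "z ^ i = z ^ j" "i \<le> j" "j < n" for i j
  proof (rule ccontr)
    assume "i \<noteq> j"
    have "z ^ i * z ^ (j - i) = z ^ i"
      using that by (metis le_add_diff_inverse power_add)
    hence "z ^ (j - i) = 1"
      using \<open>z \<noteq> 0\<close> by simp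
    thus False
      using z(2)[of "j - i"] that \<open>i \<noteq> j\<close> by auto
  qed
  have "z ^ (a mod n) = z ^ (b mod n) \<longleftrightarrow> a mod n = b mod n"
    using le[of "a mod n" "b mod n"] le[of "b mod n" "a mod n"] \<open>n > 0\<close>
    by (metis mod_less_divisor nat_le_linear)
  thus ?thesis
    using red by (metis cong_def)
qed

section \<open>Linear congruences and arithmetic progressions of residues\<close>

lemma cong_mult_lcancel_gcd_nat:
  fixes a x y n :: nat
  assumes "[a * x = a * y] (mod n)" "n > 0"
  shows "[x = y] (mod n div gcd a n)"
proof -
  obtain a' m where am: "a = a' * gcd a n" "n = m * gcd a n" "coprime a' m"
    using gcd_coprime_exists[of a n] assms(2) by auto
  define d where "d = gcd a n"
  have d: "d > 0" "a = a' * d" "n = m * d" "n div gcd a n = m"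
    using assms(2) am(1,2) by (auto simp: d_def, metis nonzero_mult_div_cancel_right gcd_eq_0_iff less_irrefl)
  \<comment> \<open>Over the integers the difference cannot truncate; \<open>d\<close> cancels
    outright, then \<open>a'\<close> because it is coprime to \<open>m\<close>.\<close>
  have "int (d * m) dvd int a * int x - int a * int y"
    using assms(1) d by (simp add: cong_iff_dvd_diff mult.commute flip: cong_int_iff)
  also have "\<dots> = int d * (int a' * (int x - int y))"
    using d by (simp add: algebra_simps)
  finally have "int m dvd int a' * (int x - int y)"
    using d by simp
  hence "int m dvd int x - int y"
    using am(3) by (metis coprime_commute coprime_dvd_mult_right_iff coprime_int_iff)
  thus ?thesis
    using d by (simp add: cong_iff_dvd_diff flip: cong_int_iff)
qed

lemma cong_imp_arith_progression_mod:
  fixes x c m d :: nat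
  assumes "[x = c] (mod m)" "x < m * d" "c < m * d"
  shows "x \<in> (\<lambda>i. (c + i * m) mod (m * d)) ` {..<d}"
proof -
  let ?n = "m * d"
  \<comment> \<open>Adding \<open>?n\<close>, a multiple of \<open>m\<close>, keeps the natural
    subtraction exact even when x < c.\<close>
  have "[c + (x + ?n - c) = c + 0] (mod m)"
    using assms by (simp add: cong_def)
  hence "m dvd x + ?n - c"
    by (metis cong_add_lcancel_nat cong_0_iff)
  then obtain i where i: "x + ?n - c = m * i" ..
  have "d > 0"
    using assms by (cases d) auto
  \<comment> \<open>The quotient \<open>i\<close> may reach \<open>d\<close> or more; reducing it
    modulo \<open>d\<close> changes \<open>i * m\<close> only by multiples of
    \<open>?n\<close>.\<close>
  have "(c + (i mod d) * m) mod ?n = (c + (m * i) mod ?n) mod ?n"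
    by (simp only: mult_mod_right[symmetric] mult.commute[of _ m])
  also have "\<dots> = (c + (x + ?n - c)) mod ?n"
    by (simp only: i mod_add_right_eq)
  also have "\<dots> = x"
    using assms by simp
  finally show ?thesis
    using \<open>d > 0\<close> by (intro image_eqI[where x = "i mod d"]) auto
qed

text \<open>The arithmetic core, free of cosets and fields: the same \<open>k\<close> is both the
  coefficient of the congruence and the size of \<open>S\<close>, which is what allows a counting
  argument.\<close>

lemma card_cong_subset_iff_arith_progression:
  fixes S :: "nat set" and n c :: nat
  assumes "S \<subseteq> {..<n}" "c \<in> S"
  defines "k \<equiv> card S"
  shows "(\<forall>x\<in>S. [k * x = k * c] (mod n)) \<longleftrightarrow>
           k dvd n \<and> S = (\<lambda>i. (c + i * (n div k)) mod n) ` {..<k}"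
proof
  have "c < n" using assms by auto
  hence "n > 0" by simp
  assume cong: "\<forall>x\<in>S. [k * x = k * c] (mod n)"
  define d where "d = gcd k n"
  let ?A = "(\<lambda>i. (c + i * (n div d)) mod n) ` {..<d}"
  have n: "n = n div d * d"
    by (simp add: d_def)
  have "finite S" using assms(1) finite_subset by blast
  hence "k > 0" using assms(2) by (auto simp: k_def card_gt_0_iff)
  have sub: "S \<subseteq> ?A"
  proof
    fix x assume "x \<in> S"
    hence "[x = c] (mod n div d)" "x < n"
      using cong_mult_lcancel_gcd_nat[of k x c n] cong \<open>n > 0\<close> assms(1) by (auto simp: d_def)
    thus "x \<in> ?A"
      using cong_imp_arith_progression_mod[of x c "n div d" d] \<open>c < n\<close> n by simp
  qed
  \<comment> \<open>The squeeze k \<le> card ?A \<le> d \<le> k forces equality throughout, so the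
    inclusion \<open>sub\<close> is an equality as well.\<close>
  have A: "card ?A \<le> d"
    using card_image_le[of "{..<d}"] by simp
  moreover have "k \<le> card ?A"
    unfolding k_def by (intro card_mono sub) auto
  moreover have "d \<le> k"
    using \<open>k > 0\<close> by (simp add: d_def gcd_le1_nat)
  ultimately have dk: "d = k" and "card S = card ?A"
    by (auto simp: k_def)
  hence "S = ?A"
    by (intro card_subset_eq sub) auto
  thus "k dvd n \<and> S = (\<lambda>i. (c + i * (n div k)) mod n) ` {..<k}"
    using dk by (metis d_def gcd_dvd2)
next
  assume *: "k dvd n \<and> S = (\<lambda>i. (c + i * (n div k)) mod n) ` {..<k}"
  show "\<forall>x\<in>S. [k * x = k * c] (mod n)"
  proof
    fix x assume "x \<in> S"
    then obtain i where i: "x = (c + i * (n div k)) mod n"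
      using * by auto
    have "[k * x = k * (c + i * (n div k))] (mod n)"
      unfolding i by (intro cong_scalar_left) simp
    also have "k * (c + i * (n div k)) = k * c + i * n"
      using * by (auto simp: algebra_simps)
    also have "[\<dots> = k * c] (mod n)"
      by (simp add: cong_def)
    finally show "[k * x = k * c] (mod n)" .
  qed
qed

section \<open>Cyclotomic cosets\<close>

context
  fixes n q \<gamma> :: nat
  assumes n: "n > 0" and coprime: "coprime n q"
begin

text \<open>Euler's theorem provides the exponent \<open>totient n\<close>, so the
  \<open>LEAST\<close> defining the period is attained.\<close>

lemma coset_period_pos: "coset_period n q \<gamma> > 0"
  and coset_period_cong: "[\<gamma> * q ^ coset_period n q \<gamma> = \<gamma>] (mod n)"
proof -
  have "[\<gamma> * q ^ totient n = \<gamma> * 1] (mod n)"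
    using euler_theorem[of q n] coprime by (intro cong_scalar_left) (simp add: coprime_commute)
  hence "\<exists>t. 0 < t \<and> [\<gamma> * q ^ t = \<gamma>] (mod n)"
    using n by (intro exI[of _ "totient n"]) auto
  from LeastI_ex[OF this]
  show "coset_period n q \<gamma> > 0" "[\<gamma> * q ^ coset_period n q \<gamma> = \<gamma>] (mod n)"
    by (auto simp: coset_period_def)
qed

text \<open>Since \<open>q ^ i\<close> is invertible modulo \<open>n\<close>, a repetition at i < j
  would make \<open>j - i\<close> a smaller period.\<close>

lemma inj_on_coset: "inj_on (\<lambda>j. (\<gamma> * q ^ j) mod n) {..<coset_period n q \<gamma>}"
proof (rule linorder_inj_onI)
  fix i j assume ij: "i < j" "i \<in> {..<coset_period n q \<gamma>}" "j \<in> {..<coset_period n q \<gamma>}"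
  show "(\<gamma> * q ^ i) mod n \<noteq> (\<gamma> * q ^ j) mod n"
  proof
    assume "(\<gamma> * q ^ i) mod n = (\<gamma> * q ^ j) mod n"
    hence "[q ^ i * (\<gamma> * q ^ (j - i)) = q ^ i * \<gamma>] (mod n)"
      using ij by (simp add: cong_def mult_ac flip: power_add)
    hence "[\<gamma> * q ^ (j - i) = \<gamma>] (mod n)"
      using coprime by (subst (asm) cong_mult_lcancel_nat) (auto simp: coprime_commute)
    moreover have "j - i < coset_period n q \<gamma>" "0 < j - i"
      using ij by auto
    ultimately show False
      using not_less_Least[of "j - i"] unfolding coset_period_def by blast
  qed
qed auto

lemma card_cyclotomic_coset: "card (cyclotomic_coset n q \<gamma>) = coset_period n q \<gamma>"
  unfolding cyclotomic_coset_def by (simp add: card_image inj_on_coset)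

lemma cyclotomic_coset_subset: "cyclotomic_coset n q \<gamma> \<subseteq> {..<n}"
  using n by (auto simp: cyclotomic_coset_def)

lemma cyclotomic_coset_self: "\<gamma> mod n \<in> cyclotomic_coset n q \<gamma>"
  unfolding cyclotomic_coset_def using coset_period_pos by (intro image_eqI[where x = 0]) auto

lemma cyclotomic_coset_mult: "(\<gamma> * q) mod n \<in> cyclotomic_coset n q \<gamma>"
\<comment> \<open>For period 1 the index 1 falls outside the range of the image, but then \<gamma> q
  is congruent to \<gamma> itself.\<close>
proof (cases "coset_period n q \<gamma> = 1")
  case True
  thus ?thesis
    using coset_period_cong cyclotomic_coset_self by (simp add: cong_def)
next
  case False
  thus ?thesis
    unfolding cyclotomic_coset_def using coset_period_pos by (intro image_eqI[where x = 1]) auto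
qed

lemma coset_poly_eq_prod_coset:
  assumes "primitive_root_of_unity n (\<zeta> n)"
  shows "coset_poly \<zeta> n q \<gamma> = (\<Prod>x\<in>cyclotomic_coset n q \<gamma>. [:- (\<zeta> n ^ x), 1:])"
proof -
  have "\<zeta> n ^ ((\<gamma> * q ^ j) mod n) = \<zeta> n ^ (\<gamma> * q ^ j)" for j
    using assms n by (simp add: primitive_root_of_unity_power_eq_iff)
  thus ?thesis
    unfolding coset_poly_def cyclotomic_coset_def by (simp add: prod.reindex inj_on_coset)
qed

end

section \<open>Binomials as products of linear factors\<close>

text \<open>If the power condition holds, both sides are monic of degree \<open>card A\<close> and
  vanish on \<open>A\<close>, so their difference has more roots than its degree allows unless it is
  zero.\<close>

lemma prod_linear_eq_binomial_iff:
  fixes A :: "'a::field set"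
  assumes "finite A" "A \<noteq> {}"
  shows "(\<Prod>x\<in>A. [:- x, 1:]) = Polynomial.monom 1 (card A) + [:c:] \<longleftrightarrow>
           (\<forall>x\<in>A. x ^ card A = - c)"
proof
  assume *: "(\<Prod>x\<in>A. [:- x, 1:]) = Polynomial.monom 1 (card A) + [:c:]"
  show "\<forall>x\<in>A. x ^ card A = - c"
  proof
    fix x assume "x \<in> A"
    hence "poly (\<Prod>x\<in>A. [:- x, 1:]) x = 0"
      using assms(1) by (auto simp: poly_prod)
    thus "x ^ card A = - c"
      unfolding * by (simp add: poly_monom eq_neg_iff_add_eq_0)
  qed
next
  assume *: "\<forall>x\<in>A. x ^ card A = - c"
  let ?p = "\<Prod>x\<in>A. [:- x, 1:]"
  have deg: "degree ?p = card A"
    by (subst degree_prod_eq_sum_degree) auto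
  have "lead_coeff ?p = 1"
    by (simp add: lead_coeff_prod)
  \<comment> \<open>In degree 0 the constant \<open>c\<close> would be added to the leading
    coefficient.\<close>
  moreover have "card A > 0"
    using assms by (simp add: card_gt_0_iff)
  ultimately show "?p = Polynomial.monom 1 (card A) + [:c:]"
    using * assms(1) deg
    by (intro poly_eqI_degree_lead_coeff[where A = A and n = "card A"])
       (auto simp: poly_monom poly_prod coeff_pCons degree_monom_le intro!: degree_add_le
         split: nat.splits)
qed

theorem theorem5p1:
  fixes q n \<gamma> :: nat
    and \<zeta> :: "nat \<Rightarrow> 'a::{field,finite} alg_closure"
  assumes "primepow q" and "CARD('a) = q"
    and "n > 0" and "coprime n q"
    and "\<gamma> < n"
    and "compatible_roots_of_unity q \<zeta>"
  shows "is_binomial_of_degree (card (cyclotomic_coset n q \<gamma>)) (coset_poly \<zeta> n q \<gamma>)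
           \<longleftrightarrow> equal_difference n q \<gamma>"
proof -
  let ?C = "cyclotomic_coset n q \<gamma>" and ?z = "\<zeta> n"
  define \<tau> where "\<tau> = card ?C"
  have z: "primitive_root_of_unity n ?z"
    using assms by (simp add: compatible_roots_of_unity_def)
  note power_eq_iff = primitive_root_of_unity_power_eq_iff[OF z \<open>n > 0\<close>]
  note coset = \<open>n > 0\<close> \<open>coprime n q\<close>
  have \<tau>: "\<tau> = coset_period n q \<gamma>"
    using card_cyclotomic_coset[OF coset] by (simp add: \<tau>_def)
  have sub: "?C \<subseteq> {..<n}" and self: "\<gamma> \<in> ?C"
    using cyclotomic_coset_subset[OF coset] cyclotomic_coset_self[OF coset, of \<gamma>] \<open>\<gamma> < n\<close> by auto
  hence fin: "finite ?C" "?C \<noteq> {}"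
    using finite_subset by auto
  \<comment> \<open>Coset elements are residues below \<open>n\<close>, so distinct ones give
    distinct roots, and the degree \<open>card ?A\<close> is indeed \<tau>.\<close>
  have inj: "inj_on (\<lambda>x. ?z ^ x) ?C"
    using sub by (auto simp: inj_on_def power_eq_iff subset_iff intro: cong_less_modulus_unique_nat)
  let ?A = "(\<lambda>x. ?z ^ x) ` ?C"
  have A: "coset_poly \<zeta> n q \<gamma> = (\<Prod>r\<in>?A. [:- r, 1:])" "card ?A = \<tau>"
    using coset_poly_eq_prod_coset[of n q \<zeta> \<gamma>] z coset inj
    by (simp_all add: prod.reindex card_image \<tau>_def)
  have map_poly_binomial: "map_poly to_ac (Polynomial.monom 1 k + [:a:]) =
      Polynomial.monom 1 k + [:to_ac a:]" for k and a :: 'a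
    by (intro poly_eqI) (simp add: coeff_map_poly coeff_pCons split: nat.splits)
  have "is_binomial_of_degree \<tau> (coset_poly \<zeta> n q \<gamma>) \<longleftrightarrow>
          (\<exists>a::'a. \<forall>x\<in>?C. (?z ^ x) ^ \<tau> = - to_ac a)"
    using prod_linear_eq_binomial_iff[of ?A] fin A
    by (simp add: is_binomial_of_degree_def map_poly_binomial)
  also have "\<dots> \<longleftrightarrow> (\<forall>x\<in>?C. [\<tau> * x = \<tau> * \<gamma>] (mod n))"
  proof
    assume "\<exists>a::'a. \<forall>x\<in>?C. (?z ^ x) ^ \<tau> = - to_ac a"
    hence "\<forall>x\<in>?C. ?z ^ (\<tau> * x) = ?z ^ (\<tau> * \<gamma>)"
      using self by (metis mult.commute power_mult)
    thus "\<forall>x\<in>?C. [\<tau> * x = \<tau> * \<gamma>] (mod n)"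
      by (simp add: power_eq_iff)
  next
    assume cong: "\<forall>x\<in>?C. [\<tau> * x = \<tau> * \<gamma>] (mod n)"
    let ?c = "?z ^ (\<tau> * \<gamma>)"
    \<comment> \<open>The congruence at the single coset element \<gamma> q shows that the q-th
      power map fixes \<open>?c\<close>, hence \<open>?c\<close> comes from the base field.\<close>
    have "[\<tau> * \<gamma> * q = \<tau> * ((\<gamma> * q) mod n)] (mod n)"
      by (simp add: cong_def mod_mult_right_eq mult.assoc)
    also have "[\<tau> * ((\<gamma> * q) mod n) = \<tau> * \<gamma>] (mod n)"
      using cong cyclotomic_coset_mult[OF coset] by blast
    finally have "?c ^ CARD('a) = ?c"
      using \<open>CARD('a) = q\<close> by (simp add: power_eq_iff flip: power_mult)
    then obtain b :: 'a where "?c = to_ac b"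
      by (auto simp: power_card_eq_self_iff_range_to_ac)
    moreover have "\<forall>x\<in>?C. (?z ^ x) ^ \<tau> = ?c"
      using cong by (simp add: power_eq_iff mult.commute flip: power_mult)
    ultimately show "\<exists>a::'a. \<forall>x\<in>?C. (?z ^ x) ^ \<tau> = - to_ac a"
      \<comment> \<open>The sign arises because the binomial is written X^\<tau> + a, whereas
        \<open>?c\<close> is the common value of the \<tau>-th powers of its roots.\<close>
      by (intro exI[of _ "- b"]) simp
  qed
  also have "\<dots> \<longleftrightarrow> equal_difference n q \<gamma>"
    using card_cong_subset_iff_arith_progression[OF sub self]
    by (simp add: equal_difference_def Let_def \<tau> flip: \<tau>_def)
  finally show ?thesis
    by (simp add: \<tau>_def)
qed

end
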